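(* Let $k\ge2$ and $m_1\ge m_2\ge \dots \ge m_k\ge1$ be integers. Then the complete $k$-partite graph $K_{m_1,m_2,\dots,m_k}$ is of non-QE class if and only if one of the following holds: (i) $m_1\ge3$ and $m_2\ge2$; (ii) $k\ge3$, $m_1\ge5$ and $m_2=\dots=m_k=1$; (iii) $k\ge4$, $m_1=4$ and $m_2=\dots=m_k=1$; (iv) $k\ge5$, $m_1=3$ and $m_2=\dots=m_k=1$.
   Context: Graphs are finite, simple and connected, with graph distance $d(x,y)$. A quadratic embedding of a graph $G=(V,E)$ is a map $\varphi:V\to\mathbb{R}^N$ (for some $N$) with $\|\varphi(x)-\varphi(y)\|^2=d(x,y)$ for all $x,y\in V$. $G$ is of QE class if it admits a quadratic embedding and of non-QE class otherwise. (Equivalently, by Schoenberg's theorem, $G$ is of non-QE class iff $\langle f,Df\rangle>0$ for some real vector $f$ on $V$ with $\sum_x f(x)=0$, where $D=[d(x,y)]$ is the distance matrix.) The complete $k$-partite graph $K_{m_1,\dots,m_k}$ has vertex set the disjoint union of sets $V_1,\dots,V_k$ with $|V_i|=m_i$, two vertices being adjacent iff they lie in different parts. *)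

theory Defs
  imports
    "Graph_Theory.Graph_Theory"
    "HOL-Analysis.L2_Norm"
    "HOL-Library.Disjoint_Sets"
begin

text \<open>
  A finite simple graph is a pre-digraph satisfying the locale \<open>graph\<close> (finite, loop-free, without
  parallel arcs, symmetric); an undirected edge is a pair of opposite arcs.
\<close>

text \<open>
  With all arc costs equal to 1 the cost of a walk is its length, so this is the usual graph
  distance, with value \<open>\<infinity>\<close> if there is no walk.
\<close>
definition graph_dist :: "('a, 'b) pre_digraph \<Rightarrow> 'a \<Rightarrow> 'a \<Rightarrow> ereal" where
  "graph_dist G x y = wf_digraph.\<mu> G (\<lambda>_. 1) x y"

text \<open>
  A vector of \<open>\<real>\<^sup>N\<close> is given by its coordinates \<open>0, \<dots>, N - 1\<close>, since \<open>N\<close> is quantified existentially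
  in \<open>qe_class\<close>; \<open>L2_set\<close> is the Euclidean norm.
\<close>
definition quadratic_embedding ::
    "('a, 'b) pre_digraph \<Rightarrow> nat \<Rightarrow> ('a \<Rightarrow> nat \<Rightarrow> real) \<Rightarrow> bool" where
  "quadratic_embedding G N \<phi> \<longleftrightarrow>
     (\<forall>x \<in> verts G. \<forall>y \<in> verts G.
        ereal ((L2_set (\<lambda>i. \<phi> x i - \<phi> y i) {..<N})\<^sup>2) = graph_dist G x y)"

text \<open>Both classes are meant for connected graphs only.\<close>

definition qe_class :: "('a, 'b) pre_digraph \<Rightarrow> bool" where
  "qe_class G \<longleftrightarrow> (\<exists>N \<phi>. quadratic_embedding G N \<phi>)"

abbreviation non_qe_class :: "('a, 'b) pre_digraph \<Rightarrow> bool" where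
  "non_qe_class G \<equiv> \<not> qe_class G"

text \<open>
  \<open>G\<close> is a \<open>K\<^bsub>m 1, \<dots>, m k\<^esub>\<close>; compare \<open>complete_bipartite_digraph\<close>. Finiteness of the parts is part
  of \<open>graph G\<close>.
\<close>
definition complete_multipartite_graph ::
    "nat \<Rightarrow> (nat \<Rightarrow> nat) \<Rightarrow> ('a, 'b) pre_digraph \<Rightarrow> bool" where
  "complete_multipartite_graph k m G \<longleftrightarrow>
     graph G \<and>
     (\<exists>V. verts G = (\<Union>i\<in>{1..k}. V i) \<and>
          disjoint_family_on V {1..k} \<and>
          (\<forall>i\<in>{1..k}. card (V i) = m i) \<and>
          arcs_ends G = {(u, v). \<exists>i\<in>{1..k}. \<exists>j\<in>{1..k}. i \<noteq> j \<and> u \<in> V i \<and> v \<in> V j})"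

lemma complete_multipartite_graph_connected:
  assumes G: "complete_multipartite_graph k m G"
    and k: "2 \<le> k" and m: "\<And>i. i \<in> {1..k} \<Longrightarrow> 1 \<le> m i"
  shows "Digraph_Component.connected G"
proof -
  from G interpret graph G by (simp add: complete_multipartite_graph_def)
  from G obtain V where V: "verts G = (\<Union>i\<in>{1..k}. V i)"
    and card: "\<And>i. i \<in> {1..k} \<Longrightarrow> card (V i) = m i"
    and E: "arcs_ends G = {(u, v). \<exists>i\<in>{1..k}. \<exists>j\<in>{1..k}. i \<noteq> j \<and> u \<in> V i \<and> v \<in> V j}"
    unfolding complete_multipartite_graph_def by blast
  have nonempty: "V i \<noteq> {}" if "i \<in> {1..k}" for i
    using card[OF that] m[OF that] by auto
  have adj: "u \<rightarrow>\<^bsub>G\<^esub> v" if "i \<in> {1..k}" "j \<in> {1..k}" "i \<noteq> j" "u \<in> V i" "v \<in> V j" for i j u v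
    unfolding E using that by blast
  have "u \<rightarrow>\<^sup>*\<^bsub>G\<^esub> v" if uv: "u \<in> verts G" "v \<in> verts G" for u v
  proof -
    from uv obtain i j where ij: "i \<in> {1..k}" "u \<in> V i" "j \<in> {1..k}" "v \<in> V j"
      unfolding V by blast
    show ?thesis
    proof (cases "i = j")
      case False
      with ij show ?thesis by (intro reachable_adjI adj) auto
    next
      case True
      define l where "l = (if i = 1 then 2 else 1 :: nat)"
      have l: "l \<in> {1..k}" "l \<noteq> i" using k by (auto simp: l_def)
      then obtain w where w: "w \<in> V l" using nonempty by blast
      have "u \<rightarrow>\<^bsub>G\<^esub> w" "w \<rightarrow>\<^bsub>G\<^esub> v"
        using adj[of i l u w] adj[of l j w v] ij l w True by auto
      then show ?thesis by (blast intro: adj_reachable_trans)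
    qed
  qed
  moreover have "verts G \<noteq> {}"
  proof -
    have "1 \<in> {1..k}" using k by simp
    with nonempty show ?thesis unfolding V by blast
  qed
  ultimately show ?thesis
    by (simp add: Digraph_Component.connected_def strongly_connected_def reachable_mk_symmetricI)
qed

lemma complete_multipartite_graph_exists:
  "\<exists>G :: (nat \<times> nat, (nat \<times> nat) \<times> (nat \<times> nat)) pre_digraph. complete_multipartite_graph k m G"
proof -
  define V where "V i = {i} \<times> {..<m i}" for i :: nat
  define W where "W = (\<Union>i\<in>{1..k}. V i)"
  define H where "H = \<lparr> pverts = W, parcs = {(u, v). u \<in> W \<and> v \<in> W \<and> fst u \<noteq> fst v} \<rparr>"
  have "finite W" by (simp add: W_def V_def)
  then have "finite {(u, v). u \<in> W \<and> v \<in> W \<and> fst u \<noteq> fst v}"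
    by (rule_tac finite_subset[of _ "W \<times> W"]) auto
  with \<open>finite W\<close> interpret pair_graph H
    by unfold_locales (auto simp: H_def symmetric_def sym_def)
  have "complete_multipartite_graph k m (with_proj H)"
    unfolding complete_multipartite_graph_def
  proof (intro conjI exI[of _ V])
    show "graph (with_proj H)" by (rule pair_graphD_graph)
  qed (auto simp: H_def W_def V_def disjoint_family_on_def)
  then show ?thesis by blast
qed

end

theory Submission
  imports Defs
begin

text \<open>
  Let \<open>A\<close> and \<open>B\<close> be disjoint sets of vertices. Pairing the squared distances with the vector that is
  supported on \<open>A \<union> B\<close>, constant on \<open>A\<close> and on \<open>B\<close> and has total sum 0 shows that a
  quadratic embedding forces \<open>c \<cdot> |A| (|B| - 1) \<le> 2 |B|\<close> whenever \<open>A\<close> has mutual distances 2,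
  \<open>B\<close> has mutual distances \<open>c\<close>, and all distances between \<open>A\<close> and \<open>B\<close> are 1. With two parts of sizes
  at least 3 and 2 this fails. If all parts but one are singletons, the inequality (with \<open>c = 1\<close>) is
  also sufficient: \<open>A\<close> and \<open>B\<close> are embedded as regular simplices in orthogonal subspaces, and
  the inequality says exactly that the centroids can be placed at a distance that makes the
  distances between \<open>A\<close> and \<open>B\<close> equal to 1. If all parts have at most two elements, the graph embeds
  into the vertices of a cross-polytope.
\<close>

section \<open>Graph distances up to two\<close>

text \<open>The distance is an infimum of walk costs, and with unit arc costs a walk that is no
  longer than any other attains it. Exhibiting a shortest walk therefore suffices.\<close>

lemma graph_dist_eqI:
  assumes "wf_digraph G" "pre_digraph.awalk G x p y"
    and "\<And>q. pre_digraph.awalk G x q y \<Longrightarrow> length p \<le> length q"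
  shows "graph_dist G x y = ereal (length p)"
proof -
  interpret wf_digraph G by fact
  have cost: "awalk_cost (\<lambda>_. 1) q = length q" for q
    by (induction q) auto
  show ?thesis
    unfolding graph_dist_def \<mu>_def cost
    by (rule antisym) (use assms in \<open>auto intro!: INF_greatest INF_lower2[of p]\<close>)
qed

lemma graph_dist_refl:
  assumes "wf_digraph G" "x \<in> verts G"
  shows "graph_dist G x x = 0"
proof -
  interpret wf_digraph G by fact
  show ?thesis
    using graph_dist_eqI[of G x "[]" x] assms by (simp add: awalk_Nil_iff zero_ereal_def)
qed

lemma graph_dist_adjacent:
  assumes "wf_digraph G" "x \<rightarrow>\<^bsub>G\<^esub> y" "x \<noteq> y"
  shows "graph_dist G x y = 1"
proof -
  interpret wf_digraph G by fact
  obtain e where e: "e \<in> arcs G" "tail G e = x" "head G e = y"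
    using assms(2) by (auto simp: arcs_ends_conv)
  have "awalk x [e] y"
    using arc_implies_awalk[OF e(1)] e by simp
  moreover have "length [e] \<le> length q" if "awalk x q y" for q
    using that assms(3) by (cases q) (auto simp: awalk_Nil_iff)
  ultimately show ?thesis
    using graph_dist_eqI[OF assms(1), of x "[e]" y] by (simp add: one_ereal_def)
qed

lemma graph_dist_common_neighbour:
  assumes "wf_digraph G" "x \<rightarrow>\<^bsub>G\<^esub> z" "z \<rightarrow>\<^bsub>G\<^esub> y" "x \<noteq> y" "\<not> x \<rightarrow>\<^bsub>G\<^esub> y"
  shows "graph_dist G x y = 2"
proof -
  interpret wf_digraph G by fact
  obtain e f where e: "e \<in> arcs G" "tail G e = x" "head G e = z"
    and f: "f \<in> arcs G" "tail G f = z" "head G f = y"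
    using assms(2,3) by (auto simp: arcs_ends_conv)
  have "awalk x [e, f] y"
    using e f by (auto simp: awalk_Cons_iff awalk_Nil_iff)
  moreover have "length [e, f] \<le> length q" if q: "awalk x q y" for q
  proof (rule ccontr)
    assume "\<not> length [e, f] \<le> length q"
    \<comment> \<open>A walk with at most one arc would make \<open>x\<close> and \<open>y\<close>
      equal or adjacent.\<close>
    then have "q = [] \<or> (\<exists>a. q = [a])"
      by (cases q) (auto simp: Suc_le_eq)
    then show False
      using q assms(4,5) by (auto simp: awalk_Nil_iff awalk_Cons_iff arcs_ends_conv)
  qed
  ultimately show ?thesis
    using graph_dist_eqI[OF assms(1), of x "[e, f]" y] by simp
qed

section \<open>Existence and obstruction\<close>

text \<open>Coordinates may be indexed by any finite set, since a bijection with an initial segment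
  of the naturals preserves the sum of squares. The constructions below index them by vertices plus
  one extra coordinate, or by the parts.\<close>

lemma qe_classI:
  assumes "finite I"
    and dist: "\<And>x y. x \<in> verts G \<Longrightarrow> y \<in> verts G \<Longrightarrow>
      graph_dist G x y = ereal (\<Sum>i\<in>I. (\<psi> x i - \<psi> y i)\<^sup>2)"
  shows "qe_class G"
proof -
  obtain h where h: "bij_betw h {..<card I} I"
    using ex_bij_betw_nat_finite[OF assms(1)] by (auto simp: atLeast0LessThan)
  have "(L2_set (\<lambda>n. \<psi> x (h n) - \<psi> y (h n)) {..<card I})\<^sup>2 = (\<Sum>i\<in>I. (\<psi> x i - \<psi> y i)\<^sup>2)" for x y
    using sum.reindex_bij_betw[OF h, of "\<lambda>i. (\<psi> x i - \<psi> y i)\<^sup>2"]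
    by (simp add: L2_set_def sum_nonneg)
  then have "quadratic_embedding G (card I) (\<lambda>x n. \<psi> x (h n))"
    by (simp add: quadratic_embedding_def dist)
  then show ?thesis
    unfolding qe_class_def by blast
qed

lemma sum_sum_diff_squares:
  fixes g h :: "'a \<Rightarrow> real"
  shows "(\<Sum>x\<in>A. \<Sum>y\<in>B. (g x - h y)\<^sup>2) =
    card B * (\<Sum>x\<in>A. (g x)\<^sup>2) + card A * (\<Sum>y\<in>B. (h y)\<^sup>2) - 2 * sum g A * sum h B"
  by (simp add: power2_diff sum.distrib sum_subtractf sum_distrib_left[symmetric]
      sum_distrib_right[symmetric] mult.assoc)

text \<open>The right side minus the left side is twice the square of
  \<open>card B * sum g A - card A * sum g B\<close>. This is the one-coordinate case of the
  Schoenberg inequality for the vector equal to \<open>card B\<close> on \<open>A\<close> and to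
  \<open>- card A\<close> on \<open>B\<close>.\<close>

lemma two_sets_sum_diff_squares:
  fixes g :: "'a \<Rightarrow> real"
  shows "(card B)\<^sup>2 * (\<Sum>x\<in>A. \<Sum>y\<in>A. (g x - g y)\<^sup>2) + (card A)\<^sup>2 * (\<Sum>x\<in>B. \<Sum>y\<in>B. (g x - g y)\<^sup>2)
    \<le> 2 * card A * card B * (\<Sum>x\<in>A. \<Sum>y\<in>B. (g x - g y)\<^sup>2)"
proof -
  have "0 \<le> 2 * (card B * sum g A - card A * sum g B)\<^sup>2"
    by simp
  also have "\<dots> = 2 * card A * card B * (\<Sum>x\<in>A. \<Sum>y\<in>B. (g x - g y)\<^sup>2)
      - ((card B)\<^sup>2 * (\<Sum>x\<in>A. \<Sum>y\<in>A. (g x - g y)\<^sup>2) + (card A)\<^sup>2 * (\<Sum>x\<in>B. \<Sum>y\<in>B. (g x - g y)\<^sup>2))"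
    unfolding sum_sum_diff_squares by (simp add: algebra_simps power2_eq_square)
  finally show ?thesis
    by simp
qed

lemma sum_sum_offdiagonal:
  fixes c :: real
  assumes "finite A"
  shows "(\<Sum>x\<in>A. \<Sum>y\<in>A. if x = y then 0 else c) = c * card A * (real (card A) - 1)"
proof -
  have "(\<Sum>y\<in>A. if x = y then 0 else c) = c * (real (card A) - 1)" if "x \<in> A" for x
  proof -
    have "(\<Sum>y\<in>A. if x = y then 0 else c) = (\<Sum>y\<in>A. c) - (\<Sum>y\<in>A. if x = y then c else 0)"
      by (subst sum_subtractf[symmetric]) (auto intro: sum.cong)
    then show ?thesis
      using assms that by (simp add: algebra_simps)
  qed
  then show ?thesis
    by simp
qed

text \<open>The one-coordinate inequality is summed over all coordinates, which turns squared
  differences into graph distances. The constant \<open>c\<close> stays free because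
  \<open>B\<close> is later either a second part (\<open>c = 2\<close>) or a clique
  (\<open>c = 1\<close>).\<close>

lemma qe_class_two_sets:
  assumes "qe_class G" and fin: "finite A" "finite B" and ne: "A \<noteq> {}" "B \<noteq> {}"
    and verts: "A \<subseteq> verts G" "B \<subseteq> verts G"
    and AA: "\<And>x y. x \<in> A \<Longrightarrow> y \<in> A \<Longrightarrow> graph_dist G x y = ereal (if x = y then 0 else 2)"
    and BB: "\<And>x y. x \<in> B \<Longrightarrow> y \<in> B \<Longrightarrow> graph_dist G x y = ereal (if x = y then 0 else c)"
    and AB: "\<And>x y. x \<in> A \<Longrightarrow> y \<in> B \<Longrightarrow> graph_dist G x y = 1"
  shows "c * card A * (real (card B) - 1) \<le> 2 * real (card B)"
proof -
  obtain N \<phi> where \<phi>: "quadratic_embedding G N \<phi>"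
    using assms(1) unfolding qe_class_def by blast
  define D where "D x y = (\<Sum>i<N. (\<phi> x i - \<phi> y i)\<^sup>2)" for x y
  have D: "graph_dist G x y = ereal (D x y)" if "x \<in> verts G" "y \<in> verts G" for x y
    using \<phi> that by (auto simp: quadratic_embedding_def D_def L2_set_def sum_nonneg)
  have swap: "(\<Sum>x\<in>X. \<Sum>y\<in>Y. D x y) = (\<Sum>i<N. \<Sum>x\<in>X. \<Sum>y\<in>Y. (\<phi> x i - \<phi> y i)\<^sup>2)" for X Y
    unfolding D_def by (subst (2) sum.swap, subst sum.swap[of _ Y]) simp
  have "(card B)\<^sup>2 * (\<Sum>x\<in>A. \<Sum>y\<in>A. D x y) + (card A)\<^sup>2 * (\<Sum>x\<in>B. \<Sum>y\<in>B. D x y)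
      \<le> 2 * card A * card B * (\<Sum>x\<in>A. \<Sum>y\<in>B. D x y)"
    unfolding swap sum_distrib_left sum.distrib[symmetric]
    by (intro sum_mono) (use two_sets_sum_diff_squares in \<open>simp add: sum_distrib_left\<close>)
  moreover have "(\<Sum>x\<in>A. \<Sum>y\<in>A. D x y) = (\<Sum>x\<in>A. \<Sum>y\<in>A. if x = y then 0 else 2)"
    using verts AA D by (intro sum.cong) (auto simp: subset_iff)
  moreover have "(\<Sum>x\<in>B. \<Sum>y\<in>B. D x y) = (\<Sum>x\<in>B. \<Sum>y\<in>B. if x = y then 0 else c)"
    using verts BB D by (intro sum.cong) (auto simp: subset_iff)
  moreover have "(\<Sum>x\<in>A. \<Sum>y\<in>B. D x y) = (\<Sum>x\<in>A. \<Sum>y\<in>B. 1)"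
    using verts AB D by (intro sum.cong) (auto simp: subset_iff one_ereal_def)
  \<comment> \<open>The positive factor \<open>card A * card B\<close> is pulled out so that it can
    be cancelled; afterwards \<open>2 * card A * card B\<close> drops out on both sides.\<close>
  ultimately have "(real (card A) * card B) * (2 * card B * (real (card A) - 1)
      + c * card A * (real (card B) - 1)) \<le> (real (card A) * card B) * (2 * card A * card B)"
    by (simp add: sum_sum_offdiagonal fin power2_eq_square algebra_simps)
  moreover have "0 < real (card A) * card B"
    using fin ne by (simp add: card_gt_0_iff)
  ultimately have "2 * card B * (real (card A) - 1) + c * card A * (real (card B) - 1)
      \<le> 2 * card A * card B"
    by (simp only: mult_le_cancel_left_pos)
  then show ?thesis
    by (simp add: algebra_simps)
qed

section \<open>Simplices and cross-polytopes\<close>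

lemma sum_sq_vertex_minus_vertex:
  assumes "finite A" "a \<in> A" "b \<in> A" "a \<noteq> b"
  shows "(\<Sum>z\<in>A. (of_bool (z = a) - of_bool (z = b))\<^sup>2) = (2 :: real)"
proof -
  have "(\<Sum>z\<in>A. (of_bool (z = a) - of_bool (z = b))\<^sup>2)
      = (\<Sum>z\<in>A. (if z = a then 1 else 0) + (if z = b then 1 else (0 :: real)))"
    using assms(4) by (intro sum.cong) auto
  then show ?thesis
    using assms by (simp add: sum.distrib)
qed

text \<open>This is the squared circumradius of the regular simplex spanned by the standard basis
  vectors, whose edges have length \<open>sqrt 2\<close>.\<close>

lemma sum_sq_vertex_minus_centroid:
  assumes "finite A" "a \<in> A"
  shows "(\<Sum>z\<in>A. (of_bool (z = a) - 1 / card A)\<^sup>2) = 1 - 1 / real (card A)"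
proof -
  have "(\<Sum>z\<in>A. (of_bool (z = a) - 1 / card A)\<^sup>2)
      = (\<Sum>z\<in>A. (if z = a then 1 - 2 / card A else 0) + (1 / real (card A))\<^sup>2)"
    by (intro sum.cong) (auto simp: power2_eq_square algebra_simps)
  then show ?thesis
    using assms by (simp add: sum.distrib power2_eq_square)
qed

lemma qe_class_split_iff:
  assumes fin: "finite A" "finite B" and ne: "A \<noteq> {}" "B \<noteq> {}"
    and verts: "verts G = A \<union> B" and disj: "A \<inter> B = {}"
    and AA: "\<And>x y. x \<in> A \<Longrightarrow> y \<in> A \<Longrightarrow> graph_dist G x y = ereal (if x = y then 0 else 2)"
    and BB: "\<And>x y. x \<in> B \<Longrightarrow> y \<in> B \<Longrightarrow> graph_dist G x y = ereal (if x = y then 0 else 1)"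
    and AB: "\<And>x y. x \<in> A \<Longrightarrow> y \<in> B \<Longrightarrow> graph_dist G x y = 1"
    and BA: "\<And>x y. x \<in> B \<Longrightarrow> y \<in> A \<Longrightarrow> graph_dist G x y = 1"
  shows "qe_class G \<longleftrightarrow> card A * (real (card B) - 1) \<le> 2 * real (card B)"
proof
  assume "qe_class G"
  then show "card A * (real (card B) - 1) \<le> 2 * real (card B)"
    using qe_class_two_sets[OF _ fin ne _ _ AA BB AB] verts by auto
next
  assume le: "card A * (real (card B) - 1) \<le> 2 * real (card B)"
  have pos: "0 < real (card A)" "0 < real (card B)"
    using fin ne by (auto simp: card_gt_0_iff)
  \<comment> \<open>the square of the distance of the centroids of the two simplices\<close>
  define t where "t = 1 / card A - 1 / 2 + 1 / (2 * card B)"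
  \<comment> \<open>The numerator is the slack in the assumed inequality, so \<open>t\<close> is
    nonnegative exactly when that inequality holds.\<close>
  have "t = (2 * card B - card A * (real (card B) - 1)) / (2 * card A * card B)"
    using pos by (simp add: t_def field_simps)
  then have t: "0 \<le> t"
    using le by simp
  \<comment> \<open>Coordinates in \<open>A\<close> carry the simplex of \<open>A\<close>, with all
    of \<open>B\<close> at its centroid. Coordinates in \<open>B\<close> carry the simplex of
    \<open>B\<close>, scaled to edge length 1 and centred at the origin, where all of
    \<open>A\<close> lies. The coordinate \<open>None\<close> separates the two centroids by
    \<open>sqrt t\<close>.\<close>
  define \<psi> where "\<psi> x i = (case i of None \<Rightarrow> (if x \<in> A then 0 else sqrt t)
      | Some z \<Rightarrow> (if z \<in> A then (if x \<in> A then of_bool (z = x) else 1 / card A)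
          else (if x \<in> A then 0 else (of_bool (z = x) - 1 / card B) / sqrt 2)))" for x i
  define S where "S x y = (\<Sum>i\<in>insert None (Some ` (A \<union> B)). (\<psi> x i - \<psi> y i)\<^sup>2)" for x y
  have S: "S x y = (\<psi> x None - \<psi> y None)\<^sup>2 + (\<Sum>z\<in>A. (\<psi> x (Some z) - \<psi> y (Some z))\<^sup>2)
      + (\<Sum>z\<in>B. (\<psi> x (Some z) - \<psi> y (Some z))\<^sup>2)" for x y
    unfolding S_def using fin disj
    by (subst sum.insert) (auto simp: sum.reindex sum.union_disjoint)
  have notA: "x \<notin> A" if "x \<in> B" for x
    using that disj by blast
  have "S x y = (if x = y then 0 else 2)" if "x \<in> A" "y \<in> A" for x y
  proof -
    have "(\<Sum>z\<in>A. (\<psi> x (Some z) - \<psi> y (Some z))\<^sup>2)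
        = (\<Sum>z\<in>A. (of_bool (z = x) - of_bool (z = y))\<^sup>2)"
      by (intro sum.cong) (use that in \<open>auto simp: \<psi>_def\<close>)
    moreover have "(\<Sum>z\<in>B. (\<psi> x (Some z) - \<psi> y (Some z))\<^sup>2) = 0"
      using that notA by (intro sum.neutral) (auto simp: \<psi>_def)
    ultimately show ?thesis
      using that sum_sq_vertex_minus_vertex[OF fin(1) that] by (simp add: S) (simp add: \<psi>_def)
  qed
  moreover have "S x y = (if x = y then 0 else 1)" if "x \<in> B" "y \<in> B" for x y
  proof -
    have "(\<Sum>z\<in>B. (\<psi> x (Some z) - \<psi> y (Some z))\<^sup>2)
        = (\<Sum>z\<in>B. (of_bool (z = x) - of_bool (z = y))\<^sup>2 / 2)"
      using that notA
      by (intro sum.cong) (auto simp: \<psi>_def diff_divide_distrib[symmetric] power_divide)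
    moreover have "(\<Sum>z\<in>A. (\<psi> x (Some z) - \<psi> y (Some z))\<^sup>2) = 0"
      using that notA by (intro sum.neutral) (auto simp: \<psi>_def)
    moreover have "\<psi> x None = \<psi> y None"
      using that notA by (simp add: \<psi>_def)
    ultimately have "S x y = (\<Sum>z\<in>B. (of_bool (z = x) - of_bool (z = y))\<^sup>2) / 2"
      unfolding S by (simp only: sum_divide_distrib) simp
    then show ?thesis
      using sum_sq_vertex_minus_vertex[OF fin(2) that] by auto
  qed
  moreover have AB1: "S x y = 1" if "x \<in> A" "y \<in> B" for x y
  proof -
    have sumA: "(\<Sum>z\<in>A. (\<psi> x (Some z) - \<psi> y (Some z))\<^sup>2) = 1 - 1 / card A"
      unfolding sum_sq_vertex_minus_centroid[OF fin(1) that(1), symmetric]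
      by (intro sum.cong) (use that notA in \<open>auto simp: \<psi>_def\<close>)
    have sumB: "(\<Sum>z\<in>B. (\<psi> x (Some z) - \<psi> y (Some z))\<^sup>2)
        = (\<Sum>z\<in>B. (of_bool (z = y) - 1 / card B)\<^sup>2 / 2)"
      by (intro sum.cong) (use that notA in \<open>auto simp: \<psi>_def power_divide\<close>)
    have height: "(\<psi> x None - \<psi> y None)\<^sup>2 = t"
      using that notA t by (simp add: \<psi>_def)
    \<comment> \<open>Pythagoras: the squared height plus the two squared circumradii;
      \<open>t\<close> was chosen to make the total 1.\<close>
    have "S x y = t + (1 - 1 / card A) + (1 - 1 / card B) / 2"
      unfolding S sumA sumB height sum_divide_distrib[symmetric]
        sum_sq_vertex_minus_centroid[OF fin(2) that(2)] by (rule refl)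
    then show ?thesis
      by (simp add: t_def diff_divide_distrib)
  qed
  moreover have "S x y = 1" if "x \<in> B" "y \<in> A" for x y
    using AB1[OF that(2,1)] by (simp add: S_def power2_commute)
  ultimately have "graph_dist G x y = ereal (S x y)" if "x \<in> verts G" "y \<in> verts G" for x y
    using that AA BB AB BA by (auto simp: verts one_ereal_def)
  then show "qe_class G"
    using fin by (intro qe_classI[of "insert None (Some ` (A \<union> B))" _ \<psi>]) (auto simp: S_def)
qed

lemma qe_class_parts_le_2:
  assumes "finite I" and verts: "verts G = (\<Union>i\<in>I. V i)"
    and disj: "disjoint_family_on V I"
    and fin: "\<And>i. i \<in> I \<Longrightarrow> finite (V i)" and card: "\<And>i. i \<in> I \<Longrightarrow> card (V i) \<le> 2"
    and dist: "\<And>i j x y. i \<in> I \<Longrightarrow> j \<in> I \<Longrightarrow> x \<in> V i \<Longrightarrow> y \<in> V j \<Longrightarrow>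
      graph_dist G x y = ereal (if x = y then 0 else if i = j then 2 else 1)"
  shows "qe_class G"
proof -
  define p where "p i = (SOME x. x \<in> V i)" for i
  \<comment> \<open>Of two distinct vertices in a part of size at most 2, exactly one is the chosen
    representative \<open>p i\<close>.\<close>
  have pm: "y = p i \<longleftrightarrow> x \<noteq> p i" if "i \<in> I" "x \<in> V i" "y \<in> V i" "x \<noteq> y" for i x y
  proof -
    have pV: "p i \<in> V i"
      using that(2) unfolding p_def by (rule someI)
    show ?thesis
    proof (rule ccontr)
      assume "\<not> ?thesis"
      then have "card {p i, x, y} = 3"
        using that(4) by auto
      moreover have "card {p i, x, y} \<le> card (V i)"
        using that pV fin by (intro card_mono) auto
      ultimately show False
        using card[OF that(1)] by simp
    qed
  qed
  \<comment> \<open>Each part gets its own axis and occupies one or both of the antipodal points at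
    distance \<open>1 / sqrt 2\<close> from the origin. Antipodal points have squared distance 2,
    points on different axes have squared distance \<open>1 / 2 + 1 / 2\<close>.\<close>
  define \<psi> where "\<psi> x i = (if x \<in> V i then (if x = p i then 1 else -1) / sqrt 2 else 0)" for x i
  have \<psi>: "\<psi> x l = (if l = i then (if x = p i then 1 else -1) / sqrt 2 else 0)"
    if "i \<in> I" "x \<in> V i" "l \<in> I" for i x l
    using that disj by (auto simp: \<psi>_def disjoint_family_on_def)
  have "(\<Sum>l\<in>I. (\<psi> x l - \<psi> y l)\<^sup>2) = (if x = y then 0 else if i = j then 2 else 1)"
    if ij: "i \<in> I" "j \<in> I" "x \<in> V i" "y \<in> V j" for i j x y
  proof (cases "i = j")
    case True
    have "(\<Sum>l\<in>I. (\<psi> x l - \<psi> y l)\<^sup>2) = (\<Sum>l\<in>I. if l = i then (if x = y then 0 else 2) else 0)"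
      using ij True pm[of i x y]
      by (intro sum.cong) (auto simp: \<psi> power2_eq_square field_simps)
    then show ?thesis
      using ij True \<open>finite I\<close> by simp
  next
    case False
    then have "x \<noteq> y"
      using ij disj by (auto simp: disjoint_family_on_def)
    have "(\<Sum>l\<in>I. (\<psi> x l - \<psi> y l)\<^sup>2)
        = (\<Sum>l\<in>I. (if l = i then 1 / 2 else 0) + (if l = j then 1 / 2 else 0))"
      using ij False by (intro sum.cong) (auto simp: \<psi> power_divide)
    then show ?thesis
      using ij False \<open>x \<noteq> y\<close> \<open>finite I\<close> by (simp add: sum.distrib)
  qed
  then show ?thesis
    using dist by (intro qe_classI[OF \<open>finite I\<close>, of _ \<psi>]) (auto simp: verts)
qed

section \<open>Complete multipartite graphs\<close>

lemma graph_dist_complete_multipartite: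
  fixes k :: nat
  assumes "graph G" and k: "2 \<le> k"
    and verts: "verts G = (\<Union>i\<in>{1..k}. V i)"
    and disj: "disjoint_family_on V {1..k}"
    and ends: "arcs_ends G = {(u, v). \<exists>i\<in>{1..k}. \<exists>j\<in>{1..k}. i \<noteq> j \<and> u \<in> V i \<and> v \<in> V j}"
    and ne: "\<And>i. i \<in> {1..k} \<Longrightarrow> V i \<noteq> {}"
    and ij: "i \<in> {1..k}" "j \<in> {1..k}" "x \<in> V i" "y \<in> V j"
  shows "graph_dist G x y = ereal (if x = y then 0 else if i = j then 2 else 1)"
proof -
  interpret graph G by fact
  have wf: "wf_digraph G" ..
  have eq: "a = b" if "a \<in> {1..k}" "b \<in> {1..k}" "z \<in> V a" "z \<in> V b" for a b z
    using disjoint_family_onD[OF disj that(1,2)] that(3,4) by blast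
  have adj: "u \<rightarrow>\<^bsub>G\<^esub> v \<longleftrightarrow> a \<noteq> b" if "a \<in> {1..k}" "b \<in> {1..k}" "u \<in> V a" "v \<in> V b" for a b u v
    unfolding ends using that eq by blast
  consider "x = y" | "x \<noteq> y" "i \<noteq> j" | "x \<noteq> y" "i = j"
    by blast
  then show ?thesis
  proof cases
    case 1
    have "x \<in> verts G"
      unfolding verts using ij(1,3) by blast
    then show ?thesis
      using graph_dist_refl[OF wf, of x] 1 by (simp add: zero_ereal_def)
  next
    case 2
    then show ?thesis
      using graph_dist_adjacent[OF wf, of x y] adj[OF ij] by (simp add: one_ereal_def)
  next
    case 3
    \<comment> \<open>Since \<open>k\<close> is at least 2, there is another part; any vertex of it
      is a common neighbour of \<open>x\<close> and \<open>y\<close>.\<close>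
    define l where "l = (if i = 1 then 2 else 1 :: nat)"
    have l: "l \<in> {1..k}" "l \<noteq> i"
      using k by (auto simp: l_def)
    then obtain z where z: "z \<in> V l"
      using ne by blast
    have "graph_dist G x y = 2"
      using 3 ij l adj[of i l x z] adj[of l j z y] adj[OF ij] z
      by (intro graph_dist_common_neighbour[OF wf, of x z y]) auto
    then show ?thesis
      using 3 by simp
  qed
qed

theorem theorem1p2:
  fixes G :: "('a, 'b) pre_digraph" and k :: nat and m :: "nat \<Rightarrow> nat"
  assumes "k \<ge> 2"
    and "antimono_on {1..k} m" and "m k \<ge> 1"
    and "complete_multipartite_graph k m G"
  shows "non_qe_class G \<longleftrightarrow>
      (m 1 \<ge> 3 \<and> m 2 \<ge> 2) \<or>
      (k \<ge> 3 \<and> m 1 \<ge> 5 \<and> (\<forall>i\<in>{2..k}. m i = 1)) \<or>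
      (k \<ge> 4 \<and> m 1 = 4 \<and> (\<forall>i\<in>{2..k}. m i = 1)) \<or>
      (k \<ge> 5 \<and> m 1 = 3 \<and> (\<forall>i\<in>{2..k}. m i = 1))"
proof -
  obtain V where graph: "graph G" and verts: "verts G = (\<Union>i\<in>{1..k}. V i)"
    and disj: "disjoint_family_on V {1..k}"
    and card: "\<And>i. i \<in> {1..k} \<Longrightarrow> card (V i) = m i"
    and ends: "arcs_ends G = {(u, v). \<exists>i\<in>{1..k}. \<exists>j\<in>{1..k}. i \<noteq> j \<and> u \<in> V i \<and> v \<in> V j}"
    using assms(4) unfolding complete_multipartite_graph_def by blast
  have anti: "m j \<le> m i" if "i \<in> {1..k}" "j \<in> {1..k}" "i \<le> j" for i j
    using assms(2) that by (rule monotone_onD)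
  have m_pos: "1 \<le> m i" if "i \<in> {1..k}" for i
    using anti[of i k] that assms(1,3) by auto
  have fin: "finite (V i)" and ne: "V i \<noteq> {}" if "i \<in> {1..k}" for i
    using card[OF that] m_pos[OF that] by (auto intro: card_ge_0_finite)
  note dist = graph_dist_complete_multipartite[OF graph assms(1) verts disj ends ne]
  have dist_ne: "graph_dist G x y = 1"
    if "i \<in> {1..k}" "j \<in> {1..k}" "x \<in> V i" "y \<in> V j" "i \<noteq> j" for i j x y
  proof -
    have "x \<noteq> y"
      using disjoint_family_onD[OF disj that(1,2,5)] that(3,4) by blast
    then show ?thesis
      using dist[OF _ that(1-4)] that(5) by (simp add: one_ereal_def)
  qed
  have 1: "1 \<in> {1..k}" and 2: "2 \<in> {1..k}"
    using assms(1) by auto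
  consider "m 1 \<le> 2" | "m 1 \<ge> 3" "m 2 \<ge> 2" | "m 1 \<ge> 3" "m 2 = 1"
    using m_pos[OF 2] by linarith
  then show ?thesis
  proof cases
    case 1
    have "card (V i) \<le> 2" if "i \<in> {1..k}" for i
      using anti[of 1 i] card[OF that] that 1 by auto
    then have "qe_class G"
      using fin dist by (intro qe_class_parts_le_2[OF _ verts disj]) auto
    then show ?thesis
      using 1 by auto
  next
    case large: 2
    have "\<not> qe_class G"
    proof
      assume "qe_class G"
      then have "2 * real (card (V 1)) * (real (card (V 2)) - 1) \<le> 2 * real (card (V 2))"
      proof (rule qe_class_two_sets[OF _ fin[OF 1] fin[OF 2] ne[OF 1] ne[OF 2]])
        show "V 1 \<subseteq> verts G" "V 2 \<subseteq> verts G"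
          using verts 1 2 by auto
        show "graph_dist G x y = ereal (if x = y then 0 else 2)" if "x \<in> V 1" "y \<in> V 1" for x y
          using dist[OF _ 1 1 that] by simp
        show "graph_dist G x y = ereal (if x = y then 0 else 2)" if "x \<in> V 2" "y \<in> V 2" for x y
          using dist[OF _ 2 2 that] by simp
        show "graph_dist G x y = 1" if "x \<in> V 1" "y \<in> V 2" for x y
          using dist_ne[OF 1 2 that] by simp
      qed
      then have "real (m 1) * (real (m 2) - 1) \<le> real (m 2)"
        using card[OF 1] card[OF 2] by simp
      \<comment> \<open>Together with the previous bound this gives
        \<open>3 * (m 2 - 1) \<le> m 2\<close>, which fails for \<open>m 2 \<ge> 2\<close>.\<close>
      moreover have "3 * (real (m 2) - 1) \<le> real (m 1) * (real (m 2) - 1)"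
        using large by (intro mult_right_mono) auto
      ultimately show False
        using large by simp
    qed
    then show ?thesis
      using large by auto
  next
    case split: 3
    have ones: "m i = 1" if "i \<in> {2..k}" for i
      using anti[of 2 i] m_pos[of i] that split 2 by auto
    \<comment> \<open>The singleton parts together form a clique on \<open>k - 1\<close> vertices,
      so the criterion for two simplices applies.\<close>
    define B where "B = (\<Union>i\<in>{2..k}. V i)"
    have "card B = (\<Sum>i\<in>{2..k}. card (V i))"
      unfolding B_def using fin disj
      by (intro card_UN_disjoint) (auto simp: disjoint_family_on_def)
    also have "\<dots> = k - 1"
      using card ones by simp
    finally have cardB: "card B = k - 1" .
    have verts': "verts G = V 1 \<union> B"
    proof -
      have "{1..k} = insert 1 {2..k}"
        using assms(1) by auto
      then show ?thesis
        by (simp add: verts B_def)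
    qed
    have disj': "V 1 \<inter> B = {}"
    proof -
      have "V 1 \<inter> V i = {}" if "i \<in> {2..k}" for i
        using disjoint_family_onD[OF disj 1, of i] that by simp
      then show ?thesis
        unfolding B_def by blast
    qed
    have BB: "graph_dist G x y = ereal (if x = y then 0 else 1)" if xy: "x \<in> B" "y \<in> B" for x y
    proof -
      obtain i j where ij: "i \<in> {2..k}" "j \<in> {2..k}" "x \<in> V i" "y \<in> V j"
        using xy by (auto simp: B_def)
      have "x = y" if "i = j"
        using ij that card[of i] ones[of i] by (auto simp: card_1_singleton_iff)
      then show ?thesis
        using dist[of i j x y] ij by auto
    qed
    have "qe_class G \<longleftrightarrow> card (V 1) * (real (card B) - 1) \<le> 2 * real (card B)"
    proof (rule qe_class_split_iff[OF fin[OF 1] _ ne[OF 1] _ verts' disj' _ BB])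
      show "finite B" "B \<noteq> {}"
        using fin ne 2 assms(1) by (auto simp: B_def)
      show "graph_dist G x y = ereal (if x = y then 0 else 2)" if "x \<in> V 1" "y \<in> V 1" for x y
        using dist[OF _ 1 1 that] by simp
      show "graph_dist G x y = 1" if xy: "x \<in> V 1" "y \<in> B" for x y
      proof -
        obtain j where "j \<in> {2..k}" "y \<in> V j"
          using xy(2) by (auto simp: B_def)
        then show ?thesis
          using dist_ne[OF 1 _ xy(1), of j] by simp
      qed
      show "graph_dist G x y = 1" if xy: "x \<in> B" "y \<in> V 1" for x y
      proof -
        obtain j where "j \<in> {2..k}" "x \<in> V j"
          using xy(1) by (auto simp: B_def)
        then show ?thesis
          using dist_ne[OF _ 1 _ xy(2), of j] by simp
      qed
    qed auto
    also have "\<dots> \<longleftrightarrow> real (m 1) * (real k - 2) \<le> 2 * (real k - 1)"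
      using card[OF 1] cardB assms(1) by (simp add: of_nat_diff)
    finally have qe: "qe_class G \<longleftrightarrow> real (m 1) * (real k - 2) \<le> 2 * (real k - 1)" .
    \<comment> \<open>The criterion reads \<open>k \<le> 4\<close> for \<open>m 1 = 3\<close> and
      \<open>k \<le> 3\<close> for \<open>m 1 = 4\<close>. For \<open>m 1 \<ge> 5\<close> it holds
      when \<open>k = 2\<close>, whereas for \<open>k \<ge> 3\<close> it would give
      \<open>5 * (k - 2) \<le> 2 * (k - 1)\<close>, that is \<open>3 * k \<le> 8\<close>.\<close>
    consider "m 1 = 3" | "m 1 = 4" | "m 1 \<ge> 5" "k = 2" | "m 1 \<ge> 5" "k \<ge> 3"
      using split assms(1) by linarith
    then show ?thesis
    proof cases
      case 4
      then have "5 * (real k - 2) \<le> real (m 1) * (real k - 2)"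
        by (intro mult_right_mono) auto
      then have "\<not> qe_class G"
        unfolding qe using 4 by auto
      then show ?thesis
        using 4 ones by auto
    qed (use qe ones split in auto)
  qed
qed

end
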